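(* There is an absolute constant $c>0$ such that for every $x\in\mathbb R$, letting $f_x$ be the characteristic function of $\Delta(x)=[x-\tfrac12 d(x),\,x+\tfrac12 d(x)]$, one has $(Gf_x)(t)\ge c^{-1}d(x)^2$ for all $t\in\Delta(x)$.
   Context: Let $q:\mathbb R\to\mathbb R$ be measurable with $q\in L_1^{\mathrm{loc}}(\mathbb R)$ and $q(x)\ge1$ a.e. A principal fundamental system of solutions (PFSS) of $z''=q(x)z$ is a pair $u,v$ of solutions ($C^1$, derivative locally absolutely continuous, equation a.e.) such that for all $x$: $u>0$, $v>0$, $u'<0$, $v'>0$, $v'u-u'v=1$, $u(x)=v(x)\int_x^\infty v(t)^{-2}dt$, and $u,u'\to0$ as $x\to\infty$, $v,v'\to0$ as $x\to-\infty$, $v,v'\to\infty$ as $x\to\infty$, $u,|u'|\to\infty$ as $x\to-\infty$. Fix a PFSS $\{u,v\}$. The Green function is $G(x,t)=u(x)v(t)$ for $x\ge t$ and $G(x,t)=u(t)v(x)$ for $x\le t$, and $(Gf)(x)=\int_{-\infty}^\infty G(x,t)f(t)\,dt$. For each $x\in\mathbb R$, $d(x)$ denotes the unique positive solution $d$ of $d\int_{x-d}^{x+d}q(t)\,dt=2$. *)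

theory Defs
  imports "HOL-Analysis.Analysis"
begin

text \<open>Absolute continuity of a real function on a compact interval (epsilon-delta definition,
  finite families of non-overlapping subintervals).\<close>
definition abs_cont_on :: "real \<Rightarrow> real \<Rightarrow> (real \<Rightarrow> real) \<Rightarrow> bool" where
  "abs_cont_on a b g \<longleftrightarrow>
     (\<forall>e>0. \<exists>\<delta>>0. \<forall>n::nat. \<forall>s t :: nat \<Rightarrow> real.
        ((\<forall>i<n. a \<le> s i \<and> s i \<le> t i \<and> t i \<le> b) \<and>
         (\<forall>i<n. \<forall>j<n. i \<noteq> j \<longrightarrow> t i \<le> s j \<or> t j \<le> s i) \<and>
         (\<Sum>i<n. t i - s i) < \<delta>)
        \<longrightarrow> (\<Sum>i<n. \<bar>g (t i) - g (s i)\<bar>) < e)"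

definition loc_abs_cont :: "(real \<Rightarrow> real) \<Rightarrow> bool" where
  "loc_abs_cont g \<longleftrightarrow> (\<forall>a b. abs_cont_on a b g)"

text \<open>Standing hypotheses on the potential q.\<close>
definition admissible_q :: "(real \<Rightarrow> real) \<Rightarrow> bool" where
  "admissible_q q \<longleftrightarrow> q \<in> borel_measurable lborel \<and>
     (\<forall>a b. set_integrable lborel {a..b} q) \<and>
     (AE x in lborel. q x \<ge> 1)"

text \<open>A solution of z'' = q z: C^1, derivative locally absolutely continuous,
  equation holds almost everywhere.\<close>
definition is_solution :: "(real \<Rightarrow> real) \<Rightarrow> (real \<Rightarrow> real) \<Rightarrow> bool" where
  "is_solution q z \<longleftrightarrow> (\<forall>x. z differentiable at x) \<and> continuous_on UNIV (deriv z) \<and>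
     loc_abs_cont (deriv z) \<and>
     (AE x in lborel. (deriv z has_real_derivative q x * z x) (at x))"

definition PFSS :: "(real \<Rightarrow> real) \<Rightarrow> (real \<Rightarrow> real) \<Rightarrow> (real \<Rightarrow> real) \<Rightarrow> bool" where
  "PFSS q u v \<longleftrightarrow> is_solution q u \<and> is_solution q v \<and>
     (\<forall>x. u x > 0 \<and> v x > 0 \<and> deriv u x < 0 \<and> deriv v x > 0 \<and>
          deriv v x * u x - deriv u x * v x = 1 \<and>
          set_integrable lborel {x..} (\<lambda>t. 1 / (v t)\<^sup>2) \<and>
          u x = v x * (LBINT t:{x..}. 1 / (v t)\<^sup>2)) \<and>
     (u \<longlongrightarrow> 0) at_top \<and> (deriv u \<longlongrightarrow> 0) at_top \<and>
     (v \<longlongrightarrow> 0) at_bot \<and> (deriv v \<longlongrightarrow> 0) at_bot \<and>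
     filterlim v at_top at_top \<and> filterlim (deriv v) at_top at_top \<and>
     filterlim u at_top at_bot \<and> filterlim (\<lambda>x. \<bar>deriv u x\<bar>) at_top at_bot"

definition green :: "(real \<Rightarrow> real) \<Rightarrow> (real \<Rightarrow> real) \<Rightarrow> real \<Rightarrow> real \<Rightarrow> real" where
  "green u v x t = (if x \<ge> t then u x * v t else u t * v x)"

definition green_op :: "(real \<Rightarrow> real) \<Rightarrow> (real \<Rightarrow> real) \<Rightarrow> (real \<Rightarrow> real) \<Rightarrow> real \<Rightarrow> real" where
  "green_op u v f x = (LBINT t. green u v x t * f t)"

text \<open>d(x): the unique positive d with d * integral_{x-d}^{x+d} q = 2.\<close>
definition dfun :: "(real \<Rightarrow> real) \<Rightarrow> real \<Rightarrow> real" where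
  "dfun q x = (THE d. d > 0 \<and> d * (LBINT t=x-d..x+d. q t) = 2)"

definition Delta :: "(real \<Rightarrow> real) \<Rightarrow> real \<Rightarrow> real set" where
  "Delta q x = {x - dfun q x / 2 .. x + dfun q x / 2}"

end

theory Submission
  imports Defs
begin

text \<open>
  Let \<open>d = d(x)\<close>, \<open>h = d/2\<close> and \<open>\<rho> = u v\<close>. For \<open>s \<in> \<Delta>(x)\<close> the mean value theorem and
  \<open>z'' = q z\<close> bound \<open>v'(s)\<close> by \<open>v(s)/h\<close> plus \<open>v(s)\<close> times the integral of \<open>q\<close> over \<open>[s - h, s]\<close>,
  and \<open>-u'(s)\<close> likewise using \<open>[s, s + h]\<close>. Inserting both bounds into the Wronskian
  \<open>1 = v' u - u' v\<close> and using the defining property of \<open>d\<close> gives \<open>\<rho> \<ge> d/6\<close> on \<open>\<Delta>(x)\<close>.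
  Since \<open>(u/v)' = -1/v\<^sup>2 = -(u/v)/\<rho>\<close>, the ratio \<open>u/v\<close> shrinks by at most the factor \<open>exp (-6)\<close>
  across \<open>\<Delta>(x)\<close>; writing \<open>(u(b) v(a))\<^sup>2 \<cdot> (u/v)(a) = (u/v)(b) \<cdot> \<rho>(a) \<rho>(b)\<close> then gives
  \<open>G \<ge> exp (-3) d/6\<close> on \<open>\<Delta>(x) \<times> \<Delta>(x)\<close>, and integrating over \<open>\<Delta>(x)\<close> gives \<open>c = 6 exp 3\<close>.

  Bounding the increments of \<open>z'\<close> by integrals needs the fundamental theorem of calculus for
  the absolutely continuous function \<open>z'\<close>, whose derivative exists only almost everywhere.
  It follows from the estimate \<open>|g(S)| \<le> \<integral>\<^sub>S |g'|\<close> for differentiable images together with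
  the Lusin (N) property of absolutely continuous functions, which makes the image of the
  exceptional null set null.
\<close>

section \<open>Measure of differentiable images of subsets of the real line\<close>

lemma lmeasurable_vec_image:
  fixes T :: "real set"
  assumes "(vec ` T :: (real^1) set) \<in> lmeasurable"
  shows "T \<in> lmeasurable" and "measure lebesgue T = measure lebesgue (vec ` T :: (real^1) set)"
proof -
  let ?V = "vec ` T :: (real^1) set"
  have "((\<lambda>x::real^1. 1::real) has_integral measure lebesgue ?V) ?V"
    using assms by (simp add: lmeasure_integral[OF assms] lmeasurable_iff_integrable_on has_integral_integral)
  then have "(((\<lambda>x::real^1. 1::real) \<circ> vec) has_integral measure lebesgue ?V) ((\<lambda>x. x $ 1) ` ?V)"
    by (rule has_integral_vec1_I)
  then have "((\<lambda>x::real. 1::real) has_integral measure lebesgue ?V) T"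
    by (simp add: image_image o_def)
  then show "T \<in> lmeasurable" "measure lebesgue T = measure lebesgue ?V"
    using lmeasurable_iff_integrable_on lmeasure_integral integrable_on_def integral_unique by metis+
qed

lemma measure_differentiable_image_real:
  fixes h h' :: "real \<Rightarrow> real"
  assumes S: "S \<in> sets lebesgue"
    and der: "\<And>x. x \<in> S \<Longrightarrow> (h has_real_derivative h' x) (at x within S)"
    and int: "(\<lambda>x. \<bar>h' x\<bar>) integrable_on S"
  shows "h ` S \<in> lmeasurable" and "measure lebesgue (h ` S) \<le> integral S (\<lambda>x. \<bar>h' x\<bar>)"
proof -
  let ?lift = "vec :: real \<Rightarrow> real^1"
  let ?drop = "\<lambda>x::real^1. x $ 1"
  have S': "?lift ` S \<in> sets lebesgue"
    by (auto intro: differentiable_image_in_sets_lebesgue [OF S] differentiable_vec)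
  have der': "(?lift \<circ> h \<circ> ?drop has_derivative (*\<^sub>R) (h' (?drop x))) (at x within ?lift ` S)"
    if "x \<in> ?lift ` S" for x
    using that der
    by (auto simp: o_def has_real_derivative_iff_has_vector_derivative has_vector_derivative_def
        has_derivative_vector_1)
  have "((\<lambda>x. \<bar>h' (?drop x)\<bar>) \<circ> ?lift) integrable_on ?drop ` ?lift ` S"
    using int by (simp add: image_image o_def)
  then have "(\<lambda>x. \<bar>h' (?drop x)\<bar>) integrable_on ?lift ` S"
    using has_integral_vec1_D integrable_on_def by blast
  then have int': "(\<lambda>x. \<bar>det (matrix ((*\<^sub>R) (h' (?drop x))) :: real^1^1)\<bar>) integrable_on ?lift ` S"
    by simp
  have img: "(?lift \<circ> h \<circ> ?drop) ` ?lift ` S = ?lift ` h ` S"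
    by (simp add: image_image)
  have eq: "integral (?lift ` S) (\<lambda>x. \<bar>det (matrix ((*\<^sub>R) (h' (?drop x))) :: real^1^1)\<bar>)
      = integral S (\<lambda>x. \<bar>h' x\<bar>)"
    by (simp add: integral_vec1_eq image_image o_def)
  have "?lift ` h ` S \<in> lmeasurable"
    using measurable_differentiable_image[OF S' der' int'] img by simp
  moreover have "measure lebesgue (?lift ` h ` S) \<le> integral S (\<lambda>x. \<bar>h' x\<bar>)"
    using measure_differentiable_image[OF S' der' int'] img eq by simp
  ultimately show "h ` S \<in> lmeasurable" "measure lebesgue (h ` S) \<le> integral S (\<lambda>x. \<bar>h' x\<bar>)"
    using lmeasurable_vec_image[of "h ` S"] by auto
qed

section \<open>The Lusin property of absolutely continuous functions\<close>

lemma measure_continuous_image_interval: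
  fixes g :: "real \<Rightarrow> real"
  assumes "c \<le> d" and "continuous_on {c..d} g"
  obtains s t where "c \<le> s" "s \<le> t" "t \<le> d" "measure lebesgue (g ` {c..d}) = \<bar>g t - g s\<bar>"
proof -
  obtain m M where mM: "g ` {c..d} = {m..M}" "m \<le> M"
    using continuous_image_closed_interval[OF assms] by blast
  then obtain x y where "x \<in> {c..d}" "y \<in> {c..d}" "g x = m" "g y = M"
    by (metis atLeastAtMost_iff imageE order_refl)
  with mM have "c \<le> min x y" "min x y \<le> max x y" "max x y \<le> d"
    "measure lebesgue (g ` {c..d}) = \<bar>g (max x y) - g (min x y)\<bar>"
    by (auto simp: min_def max_def)
  then show thesis
    by (rule that)
qed

lemma disjoint_greaterThanLessThan_le:
  fixes c d c' d' :: real
  assumes "c < d" "c' < d'" "{c<..<d} \<inter> {c'<..<d'} = {}"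
  shows "d \<le> c' \<or> d' \<le> c"
proof (rule ccontr)
  assume "\<not> (d \<le> c' \<or> d' \<le> c)"
  then have "(max c c' + min d d') / 2 \<in> {c<..<d} \<inter> {c'<..<d'}"
    using assms(1,2) by (auto simp: max_def min_def)
  then show False
    using assms(3) by blast
qed

lemma abs_cont_on_finite_family:
  fixes g :: "real \<Rightarrow> real"
  assumes ac: "abs_cont_on a b g" and "e > 0"
  shows "\<exists>\<delta>>0. \<forall>(I :: 'i set) s t. finite I \<and> (\<forall>i\<in>I. a \<le> s i \<and> s i \<le> t i \<and> t i \<le> b) \<and>
    (\<forall>i\<in>I. \<forall>j\<in>I. i \<noteq> j \<longrightarrow> t i \<le> s j \<or> t j \<le> s i) \<and> (\<Sum>i\<in>I. t i - s i) < \<delta> \<longrightarrow>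
    (\<Sum>i\<in>I. \<bar>g (t i) - g (s i)\<bar>) < e"
proof -
  obtain \<delta> where "\<delta> > 0" and \<delta>: "\<forall>(n::nat) s t.
      (\<forall>i<n. a \<le> s i \<and> s i \<le> t i \<and> t i \<le> b) \<and>
      (\<forall>i<n. \<forall>j<n. i \<noteq> j \<longrightarrow> t i \<le> s j \<or> t j \<le> s i) \<and> (\<Sum>i<n. t i - s i) < \<delta>
      \<longrightarrow> (\<Sum>i<n. \<bar>g (t i) - g (s i)\<bar>) < e"
    using ac \<open>e > 0\<close> unfolding abs_cont_on_def by (elim allE[where x = e]) auto
  show ?thesis
  proof (intro exI[of _ \<delta>] conjI allI impI)
    fix I :: "'i set" and s t :: "'i \<Rightarrow> real"
    assume "finite I \<and> (\<forall>i\<in>I. a \<le> s i \<and> s i \<le> t i \<and> t i \<le> b) \<and>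
      (\<forall>i\<in>I. \<forall>j\<in>I. i \<noteq> j \<longrightarrow> t i \<le> s j \<or> t j \<le> s i) \<and> (\<Sum>i\<in>I. t i - s i) < \<delta>"
    then have "finite I" and st: "\<forall>i\<in>I. a \<le> s i \<and> s i \<le> t i \<and> t i \<le> b"
      and disj: "\<forall>i\<in>I. \<forall>j\<in>I. i \<noteq> j \<longrightarrow> t i \<le> s j \<or> t j \<le> s i"
      and small: "(\<Sum>i\<in>I. t i - s i) < \<delta>"
      by auto
    obtain f where f: "bij_betw f {..<card I} I"
      using ex_bij_betw_nat_finite[OF \<open>finite I\<close>] by (auto simp: atLeast0LessThan)
    have reindex: "(\<Sum>k<card I. h (f k)) = (\<Sum>i\<in>I. h i)" for h :: "'i \<Rightarrow> real"
      by (rule sum.reindex_bij_betw[OF f])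
    have "\<forall>k<card I. a \<le> s (f k) \<and> s (f k) \<le> t (f k) \<and> t (f k) \<le> b"
      using st f by (auto simp: bij_betw_def)
    moreover have "\<forall>k<card I. \<forall>l<card I. k \<noteq> l \<longrightarrow> t (f k) \<le> s (f l) \<or> t (f l) \<le> s (f k)"
    proof (intro allI impI)
      fix k l
      assume "k < card I" "l < card I" "k \<noteq> l"
      then have "f k \<in> I" "f l \<in> I" "f k \<noteq> f l"
        using f by (auto simp: bij_betw_def inj_on_def)
      then show "t (f k) \<le> s (f l) \<or> t (f l) \<le> s (f k)"
        using disj by blast
    qed
    moreover have "(\<Sum>k<card I. t (f k) - s (f k)) < \<delta>"
      using small reindex[of "\<lambda>i. t i - s i"] by simp
    ultimately have "(\<Sum>k<card I. \<bar>g (t (f k)) - g (s (f k))\<bar>) < e"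
      using \<delta>[rule_format, of "card I" "\<lambda>k. s (f k)" "\<lambda>k. t (f k)"] by blast
    then show "(\<Sum>i\<in>I. \<bar>g (t i) - g (s i)\<bar>) < e"
      using reindex[of "\<lambda>i. \<bar>g (t i) - g (s i)\<bar>"] by simp
  qed fact
qed

lemma abs_cont_on_sum_measure_image_less:
  fixes g :: "real \<Rightarrow> real"
  assumes ac: "abs_cont_on a b g" and cont: "continuous_on {a..b} g" and "e > 0"
  shows "\<exists>\<delta>>0. \<forall>(I :: 'i set) c d. finite I \<and> (\<forall>i\<in>I. a \<le> c i \<and> c i \<le> d i \<and> d i \<le> b) \<and>
    (\<forall>i\<in>I. \<forall>j\<in>I. i \<noteq> j \<longrightarrow> d i \<le> c j \<or> d j \<le> c i) \<and> (\<Sum>i\<in>I. d i - c i) < \<delta> \<longrightarrow>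
    (\<Sum>i\<in>I. measure lebesgue (g ` {c i..d i})) < e"
proof -
  obtain \<delta> where "\<delta> > 0" and \<delta>: "\<forall>(I :: 'i set) s t. finite I \<and> (\<forall>i\<in>I. a \<le> s i \<and> s i \<le> t i \<and> t i \<le> b) \<and>
    (\<forall>i\<in>I. \<forall>j\<in>I. i \<noteq> j \<longrightarrow> t i \<le> s j \<or> t j \<le> s i) \<and> (\<Sum>i\<in>I. t i - s i) < \<delta> \<longrightarrow>
    (\<Sum>i\<in>I. \<bar>g (t i) - g (s i)\<bar>) < e"
    using abs_cont_on_finite_family[OF ac \<open>e > 0\<close>] by blast
  show ?thesis
  proof (intro exI[of _ \<delta>] conjI allI impI)
    fix I :: "'i set" and c d :: "'i \<Rightarrow> real"
    assume "finite I \<and> (\<forall>i\<in>I. a \<le> c i \<and> c i \<le> d i \<and> d i \<le> b) \<and>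
      (\<forall>i\<in>I. \<forall>j\<in>I. i \<noteq> j \<longrightarrow> d i \<le> c j \<or> d j \<le> c i) \<and> (\<Sum>i\<in>I. d i - c i) < \<delta>"
    then have "finite I" and cd: "\<And>i. i \<in> I \<Longrightarrow> a \<le> c i \<and> c i \<le> d i \<and> d i \<le> b"
      and disj: "\<forall>i\<in>I. \<forall>j\<in>I. i \<noteq> j \<longrightarrow> d i \<le> c j \<or> d j \<le> c i"
      and small: "(\<Sum>i\<in>I. d i - c i) < \<delta>"
      by auto
    have "\<exists>s t. c i \<le> s \<and> s \<le> t \<and> t \<le> d i \<and> measure lebesgue (g ` {c i..d i}) = \<bar>g t - g s\<bar>"
      if "i \<in> I" for i
    proof -
      have "c i \<le> d i" "continuous_on {c i..d i} g"
        using cd[OF that] by (auto intro: continuous_on_subset[OF cont])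
      then obtain s t where "c i \<le> s" "s \<le> t" "t \<le> d i"
        "measure lebesgue (g ` {c i..d i}) = \<bar>g t - g s\<bar>"
        by (rule measure_continuous_image_interval)
      then show ?thesis
        by blast
    qed
    then obtain s t where st: "c i \<le> s i" "s i \<le> t i" "t i \<le> d i"
      "measure lebesgue (g ` {c i..d i}) = \<bar>g (t i) - g (s i)\<bar>" if "i \<in> I" for i
      by metis
    have "(\<Sum>i\<in>I. t i - s i) \<le> (\<Sum>i\<in>I. d i - c i)"
      using st by (intro sum_mono) fastforce
    moreover have "\<forall>i\<in>I. a \<le> s i \<and> s i \<le> t i \<and> t i \<le> b"
      using cd st by fastforce
    moreover have "\<forall>i\<in>I. \<forall>j\<in>I. i \<noteq> j \<longrightarrow> t i \<le> s j \<or> t j \<le> s i"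
      using disj st by (meson order_trans)
    ultimately have "(\<Sum>i\<in>I. \<bar>g (t i) - g (s i)\<bar>) < e"
      using \<delta> small \<open>finite I\<close> by fastforce
    then show "(\<Sum>i\<in>I. measure lebesgue (g ` {c i..d i})) < e"
      using st by simp
  qed fact
qed

lemma abs_cont_on_sum_measure_image_intervals_less:
  fixes g :: "real \<Rightarrow> real"
  assumes ac: "abs_cont_on a b g" and cont: "continuous_on {a..b} g" and "e > 0"
  shows "\<exists>\<delta>>0. \<forall>\<D>. finite \<D> \<and> (\<forall>K\<in>\<D>. K \<subseteq> {a..b} \<and> (\<exists>c d. K = cbox c d) \<and> interior K \<noteq> {}) \<and>
    pairwise (\<lambda>K L. interior K \<inter> interior L = {}) \<D> \<and> measure lebesgue (\<Union>\<D>) < \<delta> \<longrightarrow>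
    (\<Sum>K\<in>\<D>. measure lebesgue (g ` K)) < e"
proof -
  obtain \<delta> where "\<delta> > 0" and \<delta>: "\<forall>(I :: real set set) c d. finite I \<and>
    (\<forall>i\<in>I. a \<le> c i \<and> c i \<le> d i \<and> d i \<le> b) \<and>
    (\<forall>i\<in>I. \<forall>j\<in>I. i \<noteq> j \<longrightarrow> d i \<le> c j \<or> d j \<le> c i) \<and> (\<Sum>i\<in>I. d i - c i) < \<delta> \<longrightarrow>
    (\<Sum>i\<in>I. measure lebesgue (g ` {c i..d i})) < e"
    using abs_cont_on_sum_measure_image_less[OF ac cont \<open>e > 0\<close>] by blast
  show ?thesis
  proof (intro exI[of _ \<delta>] conjI allI impI)
    fix \<D> :: "real set set"
    assume "finite \<D> \<and> (\<forall>K\<in>\<D>. K \<subseteq> {a..b} \<and> (\<exists>c d. K = cbox c d) \<and> interior K \<noteq> {}) \<and>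
      pairwise (\<lambda>K L. interior K \<inter> interior L = {}) \<D> \<and> measure lebesgue (\<Union>\<D>) < \<delta>"
    then have "finite \<D>"
      and \<D>: "\<And>K. K \<in> \<D> \<Longrightarrow> K \<subseteq> {a..b} \<and> (\<exists>c d. K = cbox c d) \<and> interior K \<noteq> {}"
      and disj: "pairwise (\<lambda>K L. interior K \<inter> interior L = {}) \<D>"
      and small: "measure lebesgue (\<Union>\<D>) < \<delta>"
      by auto
    have K: "K = {Inf K..Sup K}" "interior K = {Inf K<..<Sup K}" "measure lebesgue K = Sup K - Inf K"
      "a \<le> Inf K" "Inf K < Sup K" "Sup K \<le> b"
      if K: "K \<in> \<D>" for K
    proof -
      obtain x y where "K = {x..y}" "interior K \<noteq> {}" "K \<subseteq> {a..b}"
        using \<D>[OF K] by auto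
      then show "K = {Inf K..Sup K}" "interior K = {Inf K<..<Sup K}" "measure lebesgue K = Sup K - Inf K"
        "a \<le> Inf K" "Inf K < Sup K" "Sup K \<le> b"
        by auto
    qed
    have "\<D> division_of \<Union>\<D>"
    proof (rule division_ofI)
      show "K \<noteq> {}" if "K \<in> \<D>" for K
        using \<D>[OF that] by auto
    qed (use \<D> disj \<open>finite \<D>\<close> in \<open>auto simp: pairwise_def\<close>)
    then have "(\<Sum>K\<in>\<D>. Sup K - Inf K) < \<delta>"
      using small content_division[of \<D>] K(3) by simp
    moreover have "\<forall>K\<in>\<D>. a \<le> Inf K \<and> Inf K \<le> Sup K \<and> Sup K \<le> b"
      using K(4-6) by (auto simp: less_imp_le)
    moreover have "\<forall>K\<in>\<D>. \<forall>L\<in>\<D>. K \<noteq> L \<longrightarrow> Sup K \<le> Inf L \<or> Sup L \<le> Inf K"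
      using disj K(2,5) unfolding pairwise_def by (metis disjoint_greaterThanLessThan_le)
    ultimately have "(\<Sum>K\<in>\<D>. measure lebesgue (g ` {Inf K..Sup K})) < e"
      using \<delta>[rule_format, of \<D> Inf Sup] \<open>finite \<D>\<close> by blast
    also have "(\<Sum>K\<in>\<D>. measure lebesgue (g ` {Inf K..Sup K})) = (\<Sum>K\<in>\<D>. measure lebesgue (g ` K))"
      using K(1) by (intro sum.cong refl) metis
    finally show "(\<Sum>K\<in>\<D>. measure lebesgue (g ` K)) < e" .
  qed fact
qed

lemma abs_cont_on_measure_image_countable_intervals_le:
  fixes g :: "real \<Rightarrow> real"
  assumes ac: "abs_cont_on a b g" and cont: "continuous_on {a..b} g" and "e > 0"
  shows "\<exists>\<delta>>0. \<forall>\<C>. countable \<C> \<and> (\<forall>K\<in>\<C>. K \<subseteq> {a..b} \<and> (\<exists>c d. K = cbox c d) \<and> interior K \<noteq> {}) \<and>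
    pairwise (\<lambda>K L. interior K \<inter> interior L = {}) \<C> \<and> \<Union>\<C> \<in> lmeasurable \<and> measure lebesgue (\<Union>\<C>) < \<delta> \<longrightarrow>
    (\<Union>K\<in>\<C>. g ` K) \<in> lmeasurable \<and> measure lebesgue (\<Union>K\<in>\<C>. g ` K) \<le> e"
proof -
  obtain \<delta> where "\<delta> > 0" and \<delta>: "\<forall>\<D>. finite \<D> \<and>
    (\<forall>K\<in>\<D>. K \<subseteq> {a..b} \<and> (\<exists>c d. K = cbox c d) \<and> interior K \<noteq> {}) \<and>
    pairwise (\<lambda>K L. interior K \<inter> interior L = {}) \<D> \<and> measure lebesgue (\<Union>\<D>) < \<delta> \<longrightarrow>
    (\<Sum>K\<in>\<D>. measure lebesgue (g ` K)) < e"
    using abs_cont_on_sum_measure_image_intervals_less[OF ac cont \<open>e > 0\<close>] by blast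
  show ?thesis
  proof (intro exI[of _ \<delta>] conjI allI impI)
    fix \<C> :: "real set set"
    assume "countable \<C> \<and> (\<forall>K\<in>\<C>. K \<subseteq> {a..b} \<and> (\<exists>c d. K = cbox c d) \<and> interior K \<noteq> {}) \<and>
      pairwise (\<lambda>K L. interior K \<inter> interior L = {}) \<C> \<and> \<Union>\<C> \<in> lmeasurable \<and> measure lebesgue (\<Union>\<C>) < \<delta>"
    then have "countable \<C>"
      and \<C>: "\<And>K. K \<in> \<C> \<Longrightarrow> K \<subseteq> {a..b} \<and> (\<exists>c d. K = cbox c d) \<and> interior K \<noteq> {}"
      and disj: "pairwise (\<lambda>K L. interior K \<inter> interior L = {}) \<C>"
      and "\<Union>\<C> \<in> lmeasurable" and small: "measure lebesgue (\<Union>\<C>) < \<delta>"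
      by auto
    have img: "g ` K \<in> lmeasurable" if "K \<in> \<C>" for K
    proof -
      have "compact K" "K \<subseteq> {a..b}"
        using \<C>[OF that] by auto
      then show ?thesis
        using continuous_on_subset[OF cont] by (simp add: compact_continuous_image lmeasurable_compact)
    qed
    have bound: "measure lebesgue (\<Union>K\<in>\<C>'. g ` K) \<le> e" if "\<C>' \<subseteq> \<C>" "finite \<C>'" for \<C>'
    proof -
      have "K \<in> sets lebesgue" if "K \<in> \<C>'" for K
        using \<C> \<open>\<C>' \<subseteq> \<C>\<close> that by (metis cbox_interval fmeasurableD lmeasurable_cbox subsetD)
      then have "\<Union>\<C>' \<in> sets lebesgue"
        using \<open>finite \<C>'\<close> by (intro sets.finite_Union) auto
      then have "measure lebesgue (\<Union>\<C>') \<le> measure lebesgue (\<Union>\<C>)"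
        using that \<open>\<Union>\<C> \<in> lmeasurable\<close> by (intro measure_mono_fmeasurable) auto
      then have "measure lebesgue (\<Union>\<C>') < \<delta>"
        using small by linarith
      moreover have "\<forall>K\<in>\<C>'. K \<subseteq> {a..b} \<and> (\<exists>c d. K = cbox c d) \<and> interior K \<noteq> {}"
        using \<C> that(1) by blast
      ultimately have "(\<Sum>K\<in>\<C>'. measure lebesgue (g ` K)) < e"
        using \<delta>[rule_format, of \<C>'] pairwise_subset[OF disj that(1)] that(2) by blast
      moreover have "measure lebesgue (\<Union>K\<in>\<C>'. g ` K) \<le> (\<Sum>K\<in>\<C>'. measure lebesgue (g ` K))"
        using img that by (intro measure_UNION_le) (auto simp: fmeasurableD)
      ultimately show ?thesis
        by linarith
    qed
    show "(\<Union>K\<in>\<C>. g ` K) \<in> lmeasurable"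
      by (rule fmeasurable_UN_bound[OF \<open>countable \<C>\<close> img bound])
    show "measure lebesgue (\<Union>K\<in>\<C>. g ` K) \<le> e"
      by (rule measure_UN_bound[OF \<open>countable \<C>\<close> img bound])
  qed fact
qed

lemma negligible_abs_cont_image:
  fixes g :: "real \<Rightarrow> real"
  assumes ac: "abs_cont_on a b g" and cont: "continuous_on {a..b} g"
    and N: "negligible N" "N \<subseteq> {a..b}"
  shows "negligible (g ` N)"
proof (cases "a < b")
  case False
  then have "N \<subseteq> {a}"
    using N by auto
  then show ?thesis
    by (meson finite_imageI finite_subset finite.intros negligible_finite)
next
  case True
  show ?thesis
    unfolding negligible_outer_le
  proof (intro allI impI)
    fix e :: real
    assume "e > 0"
    then obtain \<delta> where "\<delta> > 0" and \<delta>: "\<forall>\<C>. countable \<C> \<and>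
      (\<forall>K\<in>\<C>. K \<subseteq> {a..b} \<and> (\<exists>c d. K = cbox c d) \<and> interior K \<noteq> {}) \<and>
      pairwise (\<lambda>K L. interior K \<inter> interior L = {}) \<C> \<and> \<Union>\<C> \<in> lmeasurable \<and>
      measure lebesgue (\<Union>\<C>) < \<delta> \<longrightarrow>
      (\<Union>K\<in>\<C>. g ` K) \<in> lmeasurable \<and> measure lebesgue (\<Union>K\<in>\<C>. g ` K) \<le> e"
      using abs_cont_on_measure_image_countable_intervals_le[OF ac cont] by blast
    have "N \<in> lmeasurable" "N \<subseteq> cbox a b" "\<delta> / 2 > 0"
      using N \<open>\<delta> > 0\<close> by (auto simp: negligible_imp_measurable)
    then obtain \<C> where "countable \<C>"
      and \<C>: "\<And>K. K \<in> \<C> \<Longrightarrow> K \<subseteq> cbox a b \<and> K \<noteq> {} \<and> (\<exists>c d. K = cbox c d)"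
      and "pairwise (\<lambda>A B. interior A \<inter> interior B = {}) \<C>"
      and "\<And>u v. cbox u v \<in> \<C> \<Longrightarrow> \<exists>n. \<forall>i \<in> Basis. v \<bullet> i - u \<bullet> i = (b \<bullet> i - a \<bullet> i) / 2 ^ n"
      and int: "\<And>K. K \<in> \<C> \<Longrightarrow> box a b \<noteq> {} \<Longrightarrow> interior K \<noteq> {}"
      and "N \<subseteq> \<Union>\<C>" "\<Union>\<C> \<in> lmeasurable"
      and "measure lebesgue (\<Union>\<C>) \<le> measure lebesgue N + \<delta> / 2"
      by (rule measurable_outer_intervals_bounded) (rule that; assumption+)
    moreover have "measure lebesgue N = 0"
      using N(1) by (rule negligible_imp_measure0)
    ultimately have "(\<Union>K\<in>\<C>. g ` K) \<in> lmeasurable \<and> measure lebesgue (\<Union>K\<in>\<C>. g ` K) \<le> e"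
      using \<delta> \<C> int True \<open>\<delta> > 0\<close> by (intro \<delta>[rule_format]) auto
    moreover have "g ` N \<subseteq> (\<Union>K\<in>\<C>. g ` K)"
      using \<open>N \<subseteq> \<Union>\<C>\<close> by blast
    ultimately show "\<exists>T. g ` N \<subseteq> T \<and> T \<in> lmeasurable \<and> measure lebesgue T \<le> e"
      by blast
  qed
qed

lemma abs_cont_increment_le_measure_image:
  fixes g :: "real \<Rightarrow> real"
  assumes "a \<le> b" and cont: "continuous_on {a..b} g" and ac: "abs_cont_on a b g"
    and N: "negligible N" and image: "g ` ({a..b} - N) \<in> lmeasurable"
  shows "g b - g a \<le> measure lebesgue (g ` ({a..b} - N))"
proof (cases "g a \<le> g b")
  case False
  then show ?thesis
    using measure_nonneg[of lebesgue "g ` ({a..b} - N)"] by linarith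
next
  case True
  have image_N: "negligible (g ` (N \<inter> {a..b}))"
    by (rule negligible_abs_cont_image[OF ac cont]) (auto intro: negligible_subset[OF N])
  have "{g a..g b} \<subseteq> g ` ({a..b} - N) \<union> g ` (N \<inter> {a..b})"
  proof
    fix y
    assume "y \<in> {g a..g b}"
    then obtain x where "a \<le> x" "x \<le> b" "g x = y"
      using IVT'[of g a y b] True \<open>a \<le> b\<close> cont by auto
    then show "y \<in> g ` ({a..b} - N) \<union> g ` (N \<inter> {a..b})"
      by auto
  qed
  then have "measure lebesgue {g a..g b} \<le> measure lebesgue (g ` ({a..b} - N) \<union> g ` (N \<inter> {a..b}))"
    using image image_N by (intro measure_mono_fmeasurable) (auto simp: negligible_imp_measurable)
  also have "\<dots> = measure lebesgue (g ` ({a..b} - N))"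
    using image image_N by (intro measure_Un_null_set) (auto simp: negligible_iff_null_sets fmeasurable_def)
  finally show ?thesis
    using True by simp
qed

lemma abs_cont_increment_le_integral:
  fixes g g' p :: "real \<Rightarrow> real"
  assumes "a \<le> b"
    and cont: "continuous_on {a..b} g" and ac: "abs_cont_on a b g"
    and N: "negligible N"
    and der: "\<And>t. t \<in> {a..b} - N \<Longrightarrow> (g has_real_derivative g' t) (at t)"
    and bound: "\<And>t. t \<in> {a..b} - N \<Longrightarrow> \<bar>g' t\<bar> \<le> p t"
    and g'_meas: "g' \<in> borel_measurable lborel"
    and p_int: "p integrable_on {a..b}"
  shows "g b - g a \<le> integral {a..b} p"
proof -
  define S where "S = {a..b} - N"
  have S: "S \<in> sets lebesgue"
    unfolding S_def using N by (intro sets.Diff) (auto simp: negligible_imp_sets)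
  have derS: "(g has_real_derivative g' t) (at t within S)" if "t \<in> S" for t
    using der that unfolding S_def by (simp add: has_field_derivative_at_within)
  have spike: "negligible {x \<in> {a..b} - S. h x \<noteq> 0}" "negligible {x \<in> S - {a..b}. h x \<noteq> 0}"
    for h :: "real \<Rightarrow> real"
    unfolding S_def using N by (auto intro: negligible_subset)
  have p_int_S: "p integrable_on S" and p_eq: "integral {a..b} p = integral S p"
    using integrable_spike_set[OF p_int spike] integral_spike_set[OF spike] by auto
  have "(\<lambda>x. \<bar>g' x\<bar>) \<in> borel_measurable lborel"
    using g'_meas by measurable
  then have "(\<lambda>x. \<bar>g' x\<bar>) \<in> borel_measurable (lebesgue_on S)"
    by (intro measurable_restrict_space1 measurable_completion)
  then have g'_int: "(\<lambda>x. \<bar>g' x\<bar>) integrable_on S"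
    by (rule measurable_bounded_by_integrable_imp_integrable[OF _ p_int_S _ S])
      (use bound S_def in auto)
  note image_S = measure_differentiable_image_real[OF S derS g'_int]
  have "g b - g a \<le> measure lebesgue (g ` S)"
    unfolding S_def by (rule abs_cont_increment_le_measure_image[OF \<open>a \<le> b\<close> cont ac N])
      (use image_S S_def in simp)
  also have "\<dots> \<le> integral S (\<lambda>x. \<bar>g' x\<bar>)"
    by (rule image_S(2))
  also have "\<dots> \<le> integral S p"
    by (rule integral_le[OF g'_int p_int_S]) (use bound S_def in auto)
  finally show ?thesis
    using p_eq by simp
qed

section \<open>The potential and the function d\<close>

lemma admissible_q_integrable_on: "admissible_q q \<Longrightarrow> q integrable_on {a..b}"
  unfolding admissible_q_def using set_borel_integral_eq_integral(1) by blast

lemma AE_lborel_negligibleE: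
  fixes P :: "'a::euclidean_space \<Rightarrow> bool"
  assumes "AE x in lborel. P x"
  obtains N where "negligible N" "\<And>x. x \<notin> N \<Longrightarrow> P x"
  using AE_completion[OF assms] unfolding eventually_ae_filter_negligible by blast

lemma admissible_q_ge_1_except_negligible:
  assumes "admissible_q q"
  obtains N where "negligible N" "\<And>t. t \<notin> N \<Longrightarrow> 1 \<le> q t"
  using assms unfolding admissible_q_def by (auto elim: AE_lborel_negligibleE)

lemma interval_length_le_integral_admissible_q:
  assumes q: "admissible_q q" and "a \<le> b"
  shows "b - a \<le> integral {a..b} q"
proof -
  obtain N where N: "negligible N" "\<And>t. t \<notin> N \<Longrightarrow> 1 \<le> q t"
    using admissible_q_ge_1_except_negligible[OF q] by blast
  define q1 where "q1 t = (if t \<in> N then 1 else q t)" for t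
  have "q1 integrable_on {a..b}"
    by (rule integrable_spike[OF admissible_q_integrable_on[OF q] N(1)]) (auto simp: q1_def)
  have "integral {a..b} q1 = integral {a..b} q"
    by (rule integral_spike[OF N(1)]) (auto simp: q1_def)
  moreover have "integral {a..b} (\<lambda>t. 1) \<le> integral {a..b} q1"
    using \<open>q1 integrable_on {a..b}\<close> by (intro integral_le) (auto simp: q1_def N(2))
  ultimately have "integral {a..b} (\<lambda>t. 1) \<le> integral {a..b} q"
    by simp
  then show ?thesis
    using \<open>a \<le> b\<close> by simp
qed

lemma integral_admissible_q_mono:
  assumes q: "admissible_q q" and "a \<le> c" "c \<le> d" "d \<le> b"
  shows "integral {c..d} q \<le> integral {a..b} q"
proof -
  have "integral {a..c} q + integral {c..b} q = integral {a..b} q"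
    using assms by (intro Henstock_Kurzweil_Integration.integral_combine admissible_q_integrable_on[OF q]) auto
  moreover have "integral {c..d} q + integral {d..b} q = integral {c..b} q"
    using assms by (intro Henstock_Kurzweil_Integration.integral_combine admissible_q_integrable_on[OF q]) auto
  moreover have "0 \<le> integral {a..c} q" "0 \<le> integral {d..b} q"
    using interval_length_le_integral_admissible_q[OF q, of a c]
      interval_length_le_integral_admissible_q[OF q, of d b] assms by auto
  ultimately show ?thesis
    by linarith
qed

lemma interval_integral_admissible_q:
  assumes q: "admissible_q q" and "a \<le> b"
  shows "(LBINT t=a..b. q t) = integral {a..b} q"
proof -
  have "set_integrable lborel {a..b} q"
    using q unfolding admissible_q_def by blast
  then have "(LBINT t:{a..b}. q t) = integral {a..b} q"
    by (rule set_borel_integral_eq_integral(2))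
  moreover have "(LBINT t=a..b. q t) = (LBINT t:{a..b}. q t)"
    using \<open>a \<le> b\<close> by (rule interval_integral_Icc)
  ultimately show ?thesis
    by simp
qed

lemma continuous_on_integral_symmetric_interval:
  assumes q: "admissible_q q"
  shows "continuous_on {0..R} (\<lambda>r. integral {x - r..x + r} q)"
proof -
  define F where "F y = integral {x - R..y} q" for y
  have F: "continuous_on {x - R..x + R} F"
    unfolding F_def by (rule indefinite_integral_continuous_1[OF admissible_q_integrable_on[OF q]])
  have "continuous_on {0..R} (\<lambda>r. F (x + r) - F (x - r))"
    by (intro continuous_intros continuous_on_compose2[OF F]) auto
  moreover have "F (x + r) - F (x - r) = integral {x - r..x + r} q" if "r \<in> {0..R}" for r
  proof -
    have "integral {x - R..x - r} q + integral {x - r..x + r} q = integral {x - R..x + r} q"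
      using that by (intro Henstock_Kurzweil_Integration.integral_combine admissible_q_integrable_on[OF q]) auto
    then show ?thesis
      unfolding F_def by simp
  qed
  ultimately show ?thesis
    by (rule continuous_on_eq)
qed

lemma ex1_radius_times_integral_eq_2:
  assumes q: "admissible_q q"
  shows "\<exists>!d. d > 0 \<and> d * integral {x - d..x + d} q = 2"
proof -
  define \<phi> where "\<phi> r = r * integral {x - r..x + r} q" for r
  have ge: "2 * r \<le> integral {x - r..x + r} q" if "0 \<le> r" for r
    using interval_length_le_integral_admissible_q[OF q, of "x - r" "x + r"] that by simp
  have mono: "integral {x - r..x + r} q \<le> integral {x - s..x + s} q" if "0 \<le> r" "r \<le> s" for r s
    using integral_admissible_q_mono[OF q, of "x - s" "x - r" "x + r" "x + s"] that by simp
  have strict_mono: "\<phi> r < \<phi> s" if "0 < r" "r < s" for r s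
  proof -
    have "\<phi> r \<le> r * integral {x - s..x + s} q"
      unfolding \<phi>_def using mono[of r s] that by (intro mult_left_mono) auto
    also have "\<dots> < s * integral {x - s..x + s} q"
      using ge[of s] that by (intro mult_strict_right_mono) auto
    finally show ?thesis
      unfolding \<phi>_def .
  qed
  define r0 where "r0 = 1 / (integral {x - 1..x + 1} q + 1)"
  have r0: "0 < r0" "r0 \<le> 1"
    using ge[of 1] unfolding r0_def by auto
  have "\<phi> r0 \<le> r0 * integral {x - 1..x + 1} q"
    unfolding \<phi>_def using mono[of r0 1] r0 by (intro mult_left_mono) auto
  also have "\<dots> \<le> 1"
    using ge[of 1] unfolding r0_def by (simp add: field_simps)
  finally have "\<phi> r0 \<le> 2"
    by simp
  moreover have "2 \<le> \<phi> 2"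
    unfolding \<phi>_def using ge[of 2] by simp
  moreover have "continuous_on {r0..2} \<phi>"
    unfolding \<phi>_def using r0
    by (intro continuous_intros continuous_on_subset[OF continuous_on_integral_symmetric_interval[OF q]])
      auto
  ultimately obtain r where r: "r0 \<le> r" "r \<le> 2" "\<phi> r = 2"
    using IVT'[of \<phi> r0 2 2] r0 by auto
  show ?thesis
  proof (rule ex1I[of _ r])
    show "r > 0 \<and> r * integral {x - r..x + r} q = 2"
      using r r0 unfolding \<phi>_def by simp
    show "d = r" if "d > 0 \<and> d * integral {x - d..x + d} q = 2" for d
      using strict_mono[of d r] strict_mono[of r d] that r r0 unfolding \<phi>_def
      by (cases d r rule: linorder_cases) auto
  qed
qed

lemma
  assumes q: "admissible_q q"
  shows dfun_pos: "dfun q x > 0"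
    and dfun_integral_eq: "dfun q x * integral {x - dfun q x..x + dfun q x} q = 2"
proof -
  have "d > 0 \<and> d * (LBINT t=x-d..x+d. q t) = 2 \<longleftrightarrow> d > 0 \<and> d * integral {x - d..x + d} q = 2" for d
    by (cases "d > 0") (auto simp: interval_integral_admissible_q[OF q])
  then have "dfun q x > 0 \<and> dfun q x * integral {x - dfun q x..x + dfun q x} q = 2"
    unfolding dfun_def using theI'[OF ex1_radius_times_integral_eq_2[OF q]] by simp
  then show "dfun q x > 0" "dfun q x * integral {x - dfun q x..x + dfun q x} q = 2"
    by auto
qed

section \<open>Principal fundamental systems and the Green function\<close>

lemma is_solution_deriv_increment_le:
  assumes q: "admissible_q q" and z: "is_solution q z" and "a \<le> b"
    and bound: "\<And>t. t \<in> {a..b} \<Longrightarrow> \<bar>z t\<bar> \<le> M"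
  shows "deriv z b - deriv z a \<le> M * integral {a..b} q"
proof -
  have z_diff: "\<And>x. z differentiable at x" and z'_cont: "continuous_on UNIV (deriv z)"
    and z'_ac: "loc_abs_cont (deriv z)"
    and ae: "AE x in lborel. (deriv z has_real_derivative q x * z x) (at x)"
    using z unfolding is_solution_def by auto
  from ae obtain N1 where "negligible N1"
    and N1: "\<And>x. x \<notin> N1 \<Longrightarrow> (deriv z has_real_derivative q x * z x) (at x)"
    by (elim AE_lborel_negligibleE) blast
  obtain N2 where "negligible N2" and N2: "\<And>t. t \<notin> N2 \<Longrightarrow> 1 \<le> q t"
    using admissible_q_ge_1_except_negligible[OF q] by blast
  have "continuous_on UNIV z"
    using z_diff by (meson continuous_at_imp_continuous_on differentiable_imp_continuous_within)
  then have "z \<in> borel_measurable lborel"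
    by (simp add: borel_measurable_continuous_onI)
  moreover have "q \<in> borel_measurable lborel"
    using q unfolding admissible_q_def by blast
  ultimately have qz_meas: "(\<lambda>t. q t * z t) \<in> borel_measurable lborel"
    by measurable
  have "deriv z b - deriv z a \<le> integral {a..b} (\<lambda>t. M * q t)"
  proof (rule abs_cont_increment_le_integral[OF \<open>a \<le> b\<close>])
    show "continuous_on {a..b} (deriv z)"
      using z'_cont by (rule continuous_on_subset) auto
    show "abs_cont_on a b (deriv z)"
      using z'_ac unfolding loc_abs_cont_def by blast
    show "negligible (N1 \<union> N2)"
      using \<open>negligible N1\<close> \<open>negligible N2\<close> by auto
    show "(deriv z has_real_derivative q t * z t) (at t)" if "t \<in> {a..b} - (N1 \<union> N2)" for t
      using that N1 by auto
    show "\<bar>q t * z t\<bar> \<le> M * q t" if "t \<in> {a..b} - (N1 \<union> N2)" for t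
      using N2[of t] bound[of t] that by (simp add: abs_mult mult.commute mult_right_mono)
    show "(\<lambda>t. M * q t) integrable_on {a..b}"
      using admissible_q_integrable_on[OF q] by (rule integrable_on_mult_right)
  qed (rule qz_meas)
  then show ?thesis
    by simp
qed

lemma
  assumes "PFSS q u v"
  shows PFSS_is_solution_u: "is_solution q u" and PFSS_is_solution_v: "is_solution q v"
    and PFSS_u_pos: "u x > 0" and PFSS_v_pos: "v x > 0"
    and PFSS_deriv_u_neg: "deriv u x < 0" and PFSS_deriv_v_pos: "deriv v x > 0"
    and PFSS_wronskian: "deriv v x * u x - deriv u x * v x = 1"
    and PFSS_has_derivative_u: "(u has_real_derivative deriv u x) (at x)"
    and PFSS_has_derivative_v: "(v has_real_derivative deriv v x) (at x)"
    and PFSS_continuous_on_u: "continuous_on UNIV u"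
    and PFSS_continuous_on_v: "continuous_on UNIV v"
proof -
  show u: "is_solution q u" and v: "is_solution q v"
    using assms unfolding PFSS_def by auto
  show "u x > 0" "v x > 0" "deriv u x < 0" "deriv v x > 0" "deriv v x * u x - deriv u x * v x = 1"
    using assms unfolding PFSS_def by blast+
  show "(u has_real_derivative deriv u x) (at x)" "(v has_real_derivative deriv v x) (at x)"
    using u v unfolding is_solution_def by (auto simp: DERIV_deriv_iff_real_differentiable)
  show "continuous_on UNIV u" "continuous_on UNIV v"
    using u v unfolding is_solution_def
    by (meson continuous_at_imp_continuous_on differentiable_imp_continuous_within)+
qed

lemma PFSS_deriv_v_le:
  assumes q: "admissible_q q" and P: "PFSS q u v" and "h > 0"
  shows "deriv v s \<le> v s / h + v s * integral {s - h..s} q"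
proof -
  obtain \<xi> where \<xi>: "s - h < \<xi>" "\<xi> < s" and mvt: "v s - v (s - h) = h * deriv v \<xi>"
    using MVT2[of "s - h" s v "deriv v"] \<open>h > 0\<close> PFSS_has_derivative_v[OF P] by auto
  have "h * deriv v \<xi> \<le> v s"
    using mvt PFSS_v_pos[OF P, of "s - h"] by simp
  then have "deriv v \<xi> \<le> v s / h"
    using \<open>h > 0\<close> by (simp add: pos_le_divide_eq mult.commute)
  moreover have "\<bar>v t\<bar> \<le> v s" if "t \<in> {\<xi>..s}" for t
  proof -
    have "v t \<le> v s"
      using that PFSS_has_derivative_v[OF P] PFSS_deriv_v_pos[OF P]
      by (intro DERIV_nonneg_imp_nondecreasing[of t s v]) (auto intro: less_imp_le)
    then show ?thesis
      using PFSS_v_pos[OF P, of t] by simp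
  qed
  then have "deriv v s - deriv v \<xi> \<le> v s * integral {\<xi>..s} q"
    using is_solution_deriv_increment_le[OF q PFSS_is_solution_v[OF P]] \<xi> by simp
  moreover have "v s * integral {\<xi>..s} q \<le> v s * integral {s - h..s} q"
    using integral_admissible_q_mono[OF q, of "s - h" \<xi> s s] \<xi> PFSS_v_pos[OF P, of s]
    by (intro mult_left_mono) auto
  ultimately show ?thesis
    by linarith
qed

lemma PFSS_neg_deriv_u_le:
  assumes q: "admissible_q q" and P: "PFSS q u v" and "h > 0"
  shows "- deriv u s \<le> u s / h + u s * integral {s..s + h} q"
proof -
  obtain \<xi> where \<xi>: "s < \<xi>" "\<xi> < s + h" and mvt: "u (s + h) - u s = h * deriv u \<xi>"
    using MVT2[of s "s + h" u "deriv u"] \<open>h > 0\<close> PFSS_has_derivative_u[OF P] by auto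
  have "- (h * deriv u \<xi>) \<le> u s"
    using mvt PFSS_u_pos[OF P, of "s + h"] by simp
  then have "- deriv u \<xi> \<le> u s / h"
    using \<open>h > 0\<close> by (simp add: pos_le_divide_eq mult.commute)
  moreover have "\<bar>u t\<bar> \<le> u s" if "t \<in> {s..\<xi>}" for t
  proof -
    have "u t \<le> u s"
      using that PFSS_has_derivative_u[OF P] PFSS_deriv_u_neg[OF P]
      by (intro DERIV_nonpos_imp_nonincreasing[of s t u]) (auto intro: less_imp_le)
    then show ?thesis
      using PFSS_u_pos[OF P, of t] by simp
  qed
  then have "deriv u \<xi> - deriv u s \<le> u s * integral {s..\<xi>} q"
    using is_solution_deriv_increment_le[OF q PFSS_is_solution_u[OF P]] \<xi> by simp
  moreover have "u s * integral {s..\<xi>} q \<le> u s * integral {s..s + h} q"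
    using integral_admissible_q_mono[OF q, of s s \<xi> "s + h"] \<xi> PFSS_u_pos[OF P, of s]
    by (intro mult_left_mono) auto
  ultimately show ?thesis
    by linarith
qed

lemma PFSS_uv_lower_bound:
  assumes q: "admissible_q q" and P: "PFSS q u v" and "d > 0"
    and d: "d * integral {x - d..x + d} q = 2" and s: "\<bar>s - x\<bar> \<le> d / 2"
  shows "d / 6 \<le> u s * v s"
proof -
  define h where "h = d / 2"
  define I\<^sub>l where "I\<^sub>l = integral {s - h..s} q"
  define I\<^sub>r where "I\<^sub>r = integral {s..s + h} q"
  have "h > 0"
    using \<open>d > 0\<close> unfolding h_def by simp
  have "I\<^sub>l + I\<^sub>r = integral {s - h..s + h} q"
    unfolding I\<^sub>l_def I\<^sub>r_def using \<open>h > 0\<close>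
    by (intro Henstock_Kurzweil_Integration.integral_combine admissible_q_integrable_on[OF q]) auto
  also have "\<dots> \<le> integral {x - d..x + d} q"
    using s \<open>d > 0\<close> unfolding h_def abs_le_iff by (intro integral_admissible_q_mono[OF q]) auto
  also have "\<dots> = 2 / d"
    using d \<open>d > 0\<close> by (simp add: field_simps)
  finally have I: "I\<^sub>l + I\<^sub>r \<le> 2 / d" .
  have "1 = deriv v s * u s + (- deriv u s) * v s"
    using PFSS_wronskian[OF P, of s] by simp
  also have "\<dots> \<le> (v s / h + v s * I\<^sub>l) * u s + (u s / h + u s * I\<^sub>r) * v s"
    using PFSS_deriv_v_le[OF q P \<open>h > 0\<close>, of s] PFSS_neg_deriv_u_le[OF q P \<open>h > 0\<close>, of s]
      PFSS_u_pos[OF P, of s] PFSS_v_pos[OF P, of s]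
    unfolding I\<^sub>l_def I\<^sub>r_def by (intro add_mono mult_right_mono) auto
  also have "\<dots> = u s * v s * (2 / h + (I\<^sub>l + I\<^sub>r))"
    by (simp add: field_simps)
  also have "\<dots> \<le> u s * v s * (6 / d)"
    using I PFSS_u_pos[OF P, of s] PFSS_v_pos[OF P, of s] \<open>d > 0\<close> unfolding h_def
    by (intro mult_left_mono) auto
  finally show ?thesis
    using \<open>d > 0\<close> by (simp add: field_simps)
qed

lemma exp_lower_bound_of_deriv_ge:
  fixes w w' :: "real \<Rightarrow> real"
  assumes "a \<le> b"
    and der: "\<And>r. r \<in> {a..b} \<Longrightarrow> (w has_real_derivative w' r) (at r)"
    and ge: "\<And>r. r \<in> {a..b} \<Longrightarrow> - k * w r \<le> w' r"
  shows "exp (- k * (b - a)) * w a \<le> w b"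
proof -
  define \<phi> where "\<phi> r = w r * exp (k * r)" for r
  have "\<phi> a \<le> \<phi> b"
  proof (rule DERIV_nonneg_imp_nondecreasing[OF \<open>a \<le> b\<close>])
    fix r
    assume "a \<le> r" "r \<le> b"
    then have "(\<phi> has_real_derivative (w' r + k * w r) * exp (k * r)) (at r)"
      unfolding \<phi>_def using der by (auto intro!: derivative_eq_intros simp: algebra_simps)
    moreover have "0 \<le> (w' r + k * w r) * exp (k * r)"
      using ge[of r] \<open>a \<le> r\<close> \<open>r \<le> b\<close> by simp
    ultimately show "\<exists>y. (\<phi> has_real_derivative y) (at r) \<and> 0 \<le> y"
      by blast
  qed
  then have "w a * exp (k * a) * exp (- k * b) \<le> w b * exp (k * b) * exp (- k * b)"
    unfolding \<phi>_def by (intro mult_right_mono) auto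
  then show ?thesis
    by (simp add: mult.assoc exp_add[symmetric] algebra_simps)
qed

lemma PFSS_green_lower_bound:
  assumes q: "admissible_q q" and P: "PFSS q u v" and "d > 0"
    and d: "d * integral {x - d..x + d} q = 2"
    and "x - d / 2 \<le> a" "a \<le> b" "b \<le> x + d / 2"
  shows "exp (- 3) * d / 6 \<le> u b * v a"
proof -
  have uv: "d / 6 \<le> u r * v r" if "r \<in> {a..b}" for r
    using that assms(5-7) by (intro PFSS_uv_lower_bound[OF q P \<open>d > 0\<close> d]) (unfold abs_le_iff, auto)
  have pos: "u r > 0" "v r > 0" for r
    using PFSS_u_pos[OF P] PFSS_v_pos[OF P] by auto
  define w where "w r = u r / v r" for r
  have w_pos: "w r > 0" for r
    unfolding w_def using pos by simp
  have "exp (- (6 / d) * (b - a)) * w a \<le> w b"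
  proof (rule exp_lower_bound_of_deriv_ge[OF \<open>a \<le> b\<close>])
    fix r
    have "(w has_real_derivative (deriv u r * v r - u r * deriv v r) / (v r * v r)) (at r)"
      unfolding w_def using PFSS_has_derivative_u[OF P] PFSS_has_derivative_v[OF P] pos(2)[of r]
      by (intro DERIV_divide) auto
    then show "(w has_real_derivative - 1 / (v r)\<^sup>2) (at r)"
      using PFSS_wronskian[OF P, of r] by (simp add: power2_eq_square algebra_simps)
    assume "r \<in> {a..b}"
    then have "1 \<le> 6 / d * (u r * v r)"
      using uv[of r] \<open>d > 0\<close> by (simp add: field_simps)
    then show "- (6 / d) * w r \<le> - 1 / (v r)\<^sup>2"
      unfolding w_def using pos[of r] by (simp add: field_simps power2_eq_square)
  qed
  moreover have "exp (- 6) \<le> exp (- (6 / d) * (b - a))"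
    using assms(5-7) \<open>d > 0\<close> by (simp add: field_simps)
  ultimately have w: "exp (- 6) * w a \<le> w b"
    using w_pos[of a] by (meson mult_right_mono less_imp_le order_trans)
  have "(exp (- 3) * d / 6)\<^sup>2 * w a = exp (- 6) * w a * (d / 6) * (d / 6)"
    by (simp add: power2_eq_square exp_add[symmetric])
  also have "\<dots> \<le> w b * (u a * v a) * (u b * v b)"
    using w uv[of a] uv[of b] assms(6) \<open>d > 0\<close>
    by (intro mult_mono) (use w_pos pos in \<open>auto intro!: mult_nonneg_nonneg less_imp_le\<close>)
  also have "\<dots> = (u b * v a)\<^sup>2 * w a"
    unfolding w_def using pos[of a] pos[of b] by (simp add: field_simps power2_eq_square)
  finally have "(exp (- 3) * d / 6)\<^sup>2 \<le> (u b * v a)\<^sup>2"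
    using w_pos[of a] by simp
  then show ?thesis
    by (rule power2_le_imp_le) (use pos[of a] pos[of b] in simp)
qed

lemma green_eq_max_min: "green u v t s = u (max t s) * v (min t s)"
  by (simp add: green_def max_def min_def)

lemma continuous_on_green:
  assumes "continuous_on UNIV u" "continuous_on UNIV v"
  shows "continuous_on S (green u v t)"
  unfolding green_eq_max_min[abs_def]
  by (intro continuous_intros continuous_on_compose2[OF assms(1)] continuous_on_compose2[OF assms(2)])
    auto

lemma green_op_indicator_atLeastAtMost:
  assumes "continuous_on UNIV u" "continuous_on UNIV v"
  shows "green_op u v (indicator {a..b}) t = integral {a..b} (green u v t)"
proof -
  have "set_integrable lborel {a..b} (green u v t)"
    unfolding set_integrable_def
    using borel_integrable_compact[OF compact_Icc continuous_on_green[OF assms]] by simp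
  then have "(LINT s:{a..b}|lborel. green u v t s) = integral {a..b} (green u v t)"
    by (rule set_borel_integral_eq_integral(2))
  then show ?thesis
    unfolding green_op_def set_lebesgue_integral_def by (simp add: mult.commute)
qed

lemma PFSS_integral_green_lower_bound:
  assumes q: "admissible_q q" and P: "PFSS q u v" and "d > 0"
    and d: "d * integral {x - d..x + d} q = 2" and t: "t \<in> {x - d / 2..x + d / 2}"
  shows "exp (- 3) * d\<^sup>2 / 6 \<le> integral {x - d / 2..x + d / 2} (green u v t)"
proof -
  have "green u v t integrable_on {x - d / 2..x + d / 2}"
    using PFSS_continuous_on_u[OF P] PFSS_continuous_on_v[OF P]
    by (intro integrable_continuous_interval continuous_on_green)
  moreover have "exp (- 3) * d / 6 \<le> green u v t s" if "s \<in> {x - d / 2..x + d / 2}" for s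
    unfolding green_eq_max_min using that t
    by (intro PFSS_green_lower_bound[OF q P \<open>d > 0\<close> d]) auto
  ultimately have "integral {x - d / 2..x + d / 2} (\<lambda>s. exp (- 3) * d / 6)
      \<le> integral {x - d / 2..x + d / 2} (green u v t)"
    by (intro integral_le) auto
  then show ?thesis
    using \<open>d > 0\<close> by (simp add: power2_eq_square mult_ac)
qed

theorem lemma5p2:
  "\<exists>c>0. \<forall>q u v. admissible_q q \<longrightarrow> PFSS q u v \<longrightarrow>
     (\<forall>x. \<forall>t\<in>Delta q x.
        green_op u v (indicator (Delta q x)) t \<ge> (dfun q x)\<^sup>2 / c)"
proof (intro exI[of _ "6 * exp 3"] conjI allI impI ballI)
  fix q u v x t
  assume q: "admissible_q q" and P: "PFSS q u v" and t: "t \<in> Delta q x"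
  have "green_op u v (indicator (Delta q x)) t = integral (Delta q x) (green u v t)"
    unfolding Delta_def
    by (rule green_op_indicator_atLeastAtMost[OF PFSS_continuous_on_u[OF P] PFSS_continuous_on_v[OF P]])
  moreover have "exp (- 3) * (dfun q x)\<^sup>2 / 6 \<le> integral (Delta q x) (green u v t)"
    using t unfolding Delta_def
    by (intro PFSS_integral_green_lower_bound[OF q P dfun_pos[OF q] dfun_integral_eq[OF q]])
  ultimately show "(dfun q x)\<^sup>2 / (6 * exp 3) \<le> green_op u v (indicator (Delta q x)) t"
    by (simp add: exp_minus field_simps)
qed simp

end
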